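(* Every geometric lattice admits a total coatom ordering.
   Context: A geometric lattice is a finite, atomic, semimodular lattice (equivalently, a lattice isomorphic to the lattice of flats of a matroid). For a finite lattice $\mathcal{L}$ with order $\le$, meet $\wedge$, and an element $F \in \mathcal{L}$, let $\mathrm{coat}(F)$ denote the set of elements of $\mathcal{L}$ covered by $F$ (so $\mathrm{coat}(\hat 0) = \varnothing$). Let $\prec$ be a total order on $\mathcal{L}$. For $F \in \mathcal{L}$, a set $\mathcal{G} \subseteq \mathrm{coat}(F)$ is an initial segment covered by $F$ if for all $G, G' \in \mathrm{coat}(F)$ with $G' \in \mathcal{G}$ and $G \prec G'$ we have $G \in \mathcal{G}$. A finite lattice $\mathcal{L}$ admits a total coatom ordering if there is a total order $\prec$ on $\mathcal{L}$ such that for all $F \in \mathcal{L}$: (i) for all $G, G' \in \mathrm{coat}(F)$ with $G \prec G'$, there exists $G'' \in \mathrm{coat}(F)$ such that $G'' \prec G'$, $G' \wedge G'' \in \mathrm{coat}(G')$, and $G \wedge G' \le G''$; (ii) if $\mathcal{G}$ is a (nonempty) initial segment covered by $F$ and $G'$ is the largest element of $\mathcal{G}$ with respect to $\prec$, then the set $\mathrm{coat}_{\mathcal{G}}(G') := \{G \wedge G' \mid G \in \mathcal{G} \text{ and } G \wedge G' \in \mathrm{coat}(G')\}$ is an initial segment covered by $G'$. *)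

theory Defs
  imports Main
begin

definition (in order) covered_by :: "'a \<Rightarrow> 'a \<Rightarrow> bool" where
  "covered_by x y \<longleftrightarrow> x < y \<and> \<not> (\<exists>z. x < z \<and> z < y)"

definition (in order) coat :: "'a \<Rightarrow> 'a set" where
  "coat F = {G. covered_by G F}"

definition (in bounded_lattice) atoms :: "'a set" where
  "atoms = {a. covered_by bot a}"

text \<open>Every finite (nonempty) lattice is bounded, so the bounds in \<^class>\<open>bounded_lattice\<close> only
  give names to the least and the greatest element. In the first axiom, inserting \<^term>\<open>bot\<close>
  turns \<^term>\<open>Sup_fin\<close>, which is unspecified on the empty set, into the join of an arbitrary
  set of atoms, the empty join being \<^term>\<open>bot\<close>. Semimodularity means upper semimodularity.\<close>

class geometric_lattice = finite + bounded_lattice +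
  assumes atomic: "\<exists>A \<subseteq> atoms. x = Sup_fin (insert bot A)"
    and semimodular: "covered_by (inf x y) x \<Longrightarrow> covered_by y (sup x y)"

text \<open>A total order is given by its strict part \<open>r\<close>: \<open>(G, G') \<in> r\<close> reads \<open>G \<prec> G'\<close>.\<close>

definition initial_segment_covered_by ::
    "('a :: order \<times> 'a) set \<Rightarrow> 'a \<Rightarrow> 'a set \<Rightarrow> bool" where
  "initial_segment_covered_by r F \<G> \<longleftrightarrow>
     \<G> \<subseteq> coat F \<and>
     (\<forall>G \<in> coat F. \<forall>G' \<in> coat F. G' \<in> \<G> \<and> (G, G') \<in> r \<longrightarrow> G \<in> \<G>)"

definition coat_in :: "'a :: lattice set \<Rightarrow> 'a \<Rightarrow> 'a set" where
  "coat_in \<G> G' = {inf G G' | G. G \<in> \<G> \<and> inf G G' \<in> coat G'}"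

definition largest_in :: "('a \<times> 'a) set \<Rightarrow> 'a set \<Rightarrow> 'a \<Rightarrow> bool" where
  "largest_in r \<G> G' \<longleftrightarrow> G' \<in> \<G> \<and> (\<forall>G \<in> \<G>. G = G' \<or> (G, G') \<in> r)"

definition total_coatom_ordering :: "('a :: {finite, lattice} \<times> 'a) set \<Rightarrow> bool" where
  "total_coatom_ordering r \<longleftrightarrow>
     strict_linear_order r \<and>
     (\<forall>F.
       (\<forall>G \<in> coat F. \<forall>G' \<in> coat F. (G, G') \<in> r \<longrightarrow>
          (\<exists>G'' \<in> coat F. (G'', G') \<in> r \<and> inf G' G'' \<in> coat G' \<and> inf G G' \<le> G'')) \<and>
       (\<forall>\<G> G'. initial_segment_covered_by r F \<G> \<and> \<G> \<noteq> {} \<and> largest_in r \<G> G' \<longrightarrow>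
          initial_segment_covered_by r G' (coat_in \<G> G')))"

end

theory Submission
  imports Defs
begin

text \<open>Enumerate the atoms and order the lattice lexicographically: \<open>G \<prec> G'\<close> if the first atom lying
  below exactly one of \<open>G\<close>, \<open>G'\<close> lies below \<open>G\<close>. If \<open>H \<lessdot> G' \<lessdot> F\<close> and \<open>a \<le> F\<close> is an atom not
  below \<open>G'\<close>, then semimodularity makes \<open>a \<squnion> H\<close> a coatom of \<open>F\<close> meeting \<open>G'\<close> in \<open>H\<close>, and
  \<open>a \<squnion> H \<prec> G'\<close> as soon as \<open>H\<close> contains all atoms of \<open>G'\<close> that precede \<open>a\<close>. Both conditions
  are obtained by taking for \<open>a\<close> the atom witnessing some \<open>G \<prec> G'\<close>.\<close>

lemma mem_coat_iff: "G \<in> coat F \<longleftrightarrow> covered_by G F"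
  by (simp add: coat_def)

lemma covered_by_between:
  fixes x y z :: "'a :: order"
  assumes "covered_by x y" "x \<le> z" "z \<le> y"
  shows "z = x \<or> z = y"
  using assms unfolding covered_by_def by (metis order.order_iff_strict)

lemma covered_by_less: "covered_by x y \<Longrightarrow> x < y"
  by (simp add: covered_by_def)

lemma exists_covered_by:
  fixes x y :: "'a :: {finite, order}"
  assumes "x < y"
  obtains z where "x \<le> z" "covered_by z y"
proof -
  obtain z where z: "z \<in> {z. x \<le> z \<and> z < y}"
    and max: "\<And>w. w \<in> {z. x \<le> z \<and> z < y} \<Longrightarrow> z \<le> w \<Longrightarrow> z = w"
    using finite_has_maximal[of "{z. x \<le> z \<and> z < y}"] assms by auto
  have "\<not> (z < w \<and> w < y)" for w
    using z max[of w] by (auto intro: order.trans less_imp_le)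
  then show thesis
    using z that[of z] by (auto simp: covered_by_def)
qed

text \<open>Atomicity enters here: \<open>x\<close> is a join of atoms, so its atoms determine it.
  This is what makes comparison by atoms total.\<close>

lemma le_if_atoms_le:
  fixes x y :: "'a :: geometric_lattice"
  assumes "\<And>a. a \<in> atoms \<Longrightarrow> a \<le> x \<Longrightarrow> a \<le> y"
  shows "x \<le> y"
proof -
  obtain A where A: "A \<subseteq> atoms" "x = Sup_fin (insert bot A)"
    using atomic by blast
  have "a \<le> x" if "a \<in> A" for a
    unfolding A(2) using that by (intro Sup_fin.coboundedI) auto
  then have "a \<le> y" if "a \<in> A" for a
    using assms that A(1) by blast
  then show ?thesis
    using A by (auto intro: Sup_fin.boundedI)
qed

text \<open>Such an atom meets \<open>x\<close> in \<open>bot\<close>, so semimodularity carries the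
  covering of \<open>bot\<close> by \<open>a\<close> over to \<open>x\<close>.\<close>

lemma covered_by_sup_atom:
  fixes a x :: "'a :: geometric_lattice"
  assumes "a \<in> atoms" "\<not> a \<le> x"
  shows "covered_by x (sup a x)"
proof -
  have "covered_by bot a"
    using assms by (simp add: atoms_def)
  moreover have "inf a x = bot"
    using covered_by_between[OF \<open>covered_by bot a\<close>, of "inf a x"] assms(2)
    by (metis bot_least inf_le1 inf_le2)
  ultimately show ?thesis
    using semimodular[of a x] by simp
qed

text \<open>Semimodularity is used twice: it gives that \<open>sup a H\<close> covers
  \<open>H\<close>, and then, applied to \<open>G\<close> and \<open>sup a H\<close>, that
  \<open>F\<close> covers \<open>sup a H\<close>.\<close>

lemma exchange_coatom:
  fixes a F G H :: "'a :: geometric_lattice"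
  assumes "a \<in> atoms" "a \<le> F" "\<not> a \<le> G" "covered_by H G" "covered_by G F"
  shows "covered_by (sup a H) F" "inf G (sup a H) = H"
proof -
  let ?K = "sup a H"
  have "H < G" "G < F"
    using assms covered_by_less by auto
  have K: "covered_by H ?K"
    using assms \<open>H < G\<close> by (intro covered_by_sup_atom) auto
  \<comment> \<open>Otherwise \<open>H < G \<le> ?K\<close> forces \<open>G = ?K\<close>, which lies
    above \<open>a\<close>.\<close>
  have "\<not> G \<le> ?K"
    using covered_by_between[OF K, of G] \<open>H < G\<close> assms(3)
    by (metis less_irrefl less_imp_le sup.cobounded1)
  then show inf: "inf G ?K = H"
    using covered_by_between[OF assms(4), of "inf G ?K"] \<open>H < G\<close>
    by (metis inf.cobounded1 inf.cobounded2 le_inf_iff less_imp_le sup.cobounded2)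
  have "sup G ?K = F"
    using covered_by_between[OF assms(5), of "sup G ?K"] assms \<open>H < G\<close> \<open>G < F\<close>
    by (metis le_sup_iff less_imp_le order.trans sup.cobounded1)
  then show "covered_by ?K F"
    using semimodular[of G ?K] inf assms(4) by simp
qed

text \<open>It suffices to require one inclusion between the sets of atoms preceding \<open>a\<close>: if it is
  strict, then the first atom in which \<open>G\<close> and \<open>G'\<close> differ still lies below \<open>G\<close>.\<close>

definition lex_less :: "('a \<Rightarrow> nat) \<Rightarrow> 'a :: bounded_lattice \<Rightarrow> 'a \<Rightarrow> bool" where
  "lex_less f G G' \<longleftrightarrow> (\<exists>a \<in> atoms. a \<le> G \<and> \<not> a \<le> G' \<and>
     (\<forall>b \<in> atoms. f b < f a \<longrightarrow> b \<le> G' \<longrightarrow> b \<le> G))"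

text \<open>Of the two witnessing atoms, the one with the smaller index witnesses the composite
  comparison.\<close>

lemma lex_less_trans:
  assumes f: "inj f" and "lex_less f G G'" "lex_less f G' G''"
  shows "lex_less f G G''"
proof -
  obtain a where a: "a \<in> atoms" "a \<le> G" "\<not> a \<le> G'"
    "\<And>b. b \<in> atoms \<Longrightarrow> f b < f a \<Longrightarrow> b \<le> G' \<Longrightarrow> b \<le> G"
    using assms by (auto simp: lex_less_def)
  obtain c where c: "c \<in> atoms" "c \<le> G'" "\<not> c \<le> G''"
    "\<And>b. b \<in> atoms \<Longrightarrow> f b < f c \<Longrightarrow> b \<le> G'' \<Longrightarrow> b \<le> G'"
    using assms by (auto simp: lex_less_def)
  have "f a \<noteq> f c"
    using a c f by (auto dest: injD)
  then consider "f a < f c" | "f c < f a"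
    by linarith
  then show ?thesis
  proof cases
    case 1
    then show ?thesis
      unfolding lex_less_def using a c by (meson less_trans)
  next
    case 2
    then show ?thesis
      unfolding lex_less_def using a c by (meson less_trans)
  qed
qed

text \<open>An atom of least index in \<open>?D\<close> decides the comparison, since all earlier
  atoms lie below both elements or neither.\<close>

lemma lex_less_total:
  fixes G G' :: "'a :: geometric_lattice"
  assumes "G \<noteq> G'"
  shows "lex_less f G G' \<or> lex_less f G' G"
proof -
  let ?D = "\<lambda>a. a \<in> atoms \<and> (a \<le> G) \<noteq> (a \<le> G')"
  have "\<exists>a. ?D a"
    using assms le_if_atoms_le[of G G'] le_if_atoms_le[of G' G] by (meson order.antisym)
  then obtain a where a: "?D a" "\<And>b. ?D b \<Longrightarrow> f a \<le> f b"
    using exists_least_iff[of "\<lambda>n. \<exists>a. f a = n \<and> ?D a"] by (metis linorder_not_less)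
  have "b \<le> G \<longleftrightarrow> b \<le> G'" if "b \<in> atoms" "f b < f a" for b
    using a(2)[of b] that by auto
  then show ?thesis
    using a(1) unfolding lex_less_def by blast
qed

lemma strict_linear_order_lex_less:
  assumes "inj f"
  shows "strict_linear_order {(G, G' :: 'a :: geometric_lattice). lex_less f G G'}"
  unfolding strict_linear_order_on_def
proof (intro conjI)
  show "trans {(G, G' :: 'a). lex_less f G G'}"
    using lex_less_trans[OF assms] by (auto intro!: transI)
  show "irrefl {(G, G' :: 'a). lex_less f G G'}"
    by (auto simp: irrefl_def lex_less_def)
  show "total {(G, G' :: 'a). lex_less f G G'}"
    using lex_less_total by (auto simp: total_on_def)
qed

lemma lex_less_coat_exchange:
  fixes F G G' :: "'a :: geometric_lattice"
  assumes "G \<in> coat F" "G' \<in> coat F" "lex_less f G G'"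
  shows "\<exists>G'' \<in> coat F. lex_less f G'' G' \<and> inf G' G'' \<in> coat G' \<and> inf G G' \<le> G''"
proof -
  have cov: "covered_by G F" "covered_by G' F"
    using assms by (auto simp: mem_coat_iff)
  obtain a where a: "a \<in> atoms" "a \<le> G" "\<not> a \<le> G'"
    "\<And>b. b \<in> atoms \<Longrightarrow> f b < f a \<Longrightarrow> b \<le> G' \<Longrightarrow> b \<le> G"
    using assms by (auto simp: lex_less_def)
  have "a \<le> F"
    using a(2) covered_by_less[OF cov(1)] by order
  have "\<not> G' \<le> G"
    using covered_by_between[OF cov(2), of G] a covered_by_less[OF cov(1)]
    by (metis less_irrefl less_imp_le)
  then have "inf G G' < G'"
    using inf_le1[of G G'] inf_le2[of G G'] by (metis less_le)
  \<comment> \<open>The meet need not be a coatom of \<open>G'\<close>, so it is enlarged to one;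
    \<open>H\<close> still contains the atoms of \<open>G'\<close> preceding \<open>a\<close>, as
    these lie below \<open>G\<close>.\<close>
  then obtain H where H: "inf G G' \<le> H" "covered_by H G'"
    by (rule exists_covered_by)
  note K = exchange_coatom[OF a(1) \<open>a \<le> F\<close> a(3) H(2) cov(2)]
  have "b \<le> sup a H" if "b \<in> atoms" "f b < f a" "b \<le> G'" for b
    using a(4)[OF that] that(3) H(1) by (meson le_infI le_supI2 order.trans)
  then have "lex_less f (sup a H) G'"
    unfolding lex_less_def using a by (intro bexI[of _ a]) auto
  then show ?thesis
    using K H by (intro bexI[of _ "sup a H"]) (auto simp: mem_coat_iff intro: le_supI2)
qed

lemma initial_segment_coat_in:
  fixes F G' :: "'a :: geometric_lattice" and f :: "'a \<Rightarrow> nat"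
  defines "r \<equiv> {(G, G' :: 'a). lex_less f G G'}"
  assumes init: "initial_segment_covered_by r F \<G>" and largest: "largest_in r \<G> G'"
  shows "initial_segment_covered_by r G' (coat_in \<G> G')"
  unfolding initial_segment_covered_by_def
proof (intro conjI ballI impI; (elim conjE)?)
  show "coat_in \<G> G' \<subseteq> coat G'"
    by (auto simp: coat_in_def)
next
  fix H' H
  assume H': "H' \<in> coat G'" and H: "H \<in> coat_in \<G> G'" and less: "(H', H) \<in> r"
  have G': "G' \<in> \<G>" "G' \<in> coat F"
    using init largest by (auto simp: initial_segment_covered_by_def largest_in_def)
  obtain G where G: "G \<in> \<G>" "H = inf G G'" "H \<in> coat G'"
    using H by (auto simp: coat_in_def)
  \<comment> \<open>If they were equal, \<open>H\<close> would be \<open>G'\<close>, which is not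
    its own coatom.\<close>
  have "G \<noteq> G'"
    using G covered_by_less[of H G'] by (auto simp: mem_coat_iff)
  then have "lex_less f G G'"
    using largest G by (auto simp: largest_in_def r_def)
  then obtain a where a: "a \<in> atoms" "a \<le> G" "\<not> a \<le> G'"
    "\<And>b. b \<in> atoms \<Longrightarrow> f b < f a \<Longrightarrow> b \<le> G' \<Longrightarrow> b \<le> G"
    by (auto simp: lex_less_def)
  have "G \<in> coat F"
    using G init by (auto simp: initial_segment_covered_by_def)
  then have "a \<le> F"
    using a(2) covered_by_less[of G F] by (simp add: mem_coat_iff)
  obtain c where c: "c \<in> atoms" "c \<le> H'" "\<not> c \<le> H"
    "\<And>b. b \<in> atoms \<Longrightarrow> f b < f c \<Longrightarrow> b \<le> H \<Longrightarrow> b \<le> H'"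
    using less by (auto simp: lex_less_def r_def)
  have "c \<le> G'"
    using c(2) H' covered_by_less[of H' G'] by (simp add: mem_coat_iff)
  have in_H: "b \<le> H" if "b \<in> atoms" "f b < f a" "b \<le> G'" for b
    using a(4)[OF that] that G by simp
  \<comment> \<open>An atom of \<open>G'\<close> preceding \<open>a\<close> lies below
    \<open>H\<close>, but \<open>c\<close> does not. Hence the atoms preceding \<open>a\<close> also
    precede \<open>c\<close>, and those below \<open>H\<close> pass to \<open>H'\<close>.\<close>
  then have "f a \<le> f c"
    using c \<open>c \<le> G'\<close> by (meson not_less)
  then have "b \<le> sup a H'" if "b \<in> atoms" "f b < f a" "b \<le> G'" for b
    using c(4)[of b] in_H[OF that] that by (simp add: le_supI2)
  then have "lex_less f (sup a H') G'"
    unfolding lex_less_def using a(1,3) by (intro bexI[of _ a]) auto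
  then have "(sup a H', G') \<in> r"
    by (simp add: r_def)
  have K: "covered_by (sup a H') F" "inf G' (sup a H') = H'"
    using exchange_coatom[OF a(1) \<open>a \<le> F\<close> a(3)] H' G' by (auto simp: mem_coat_iff)
  have "sup a H' \<in> coat F"
    using K(1) by (simp add: mem_coat_iff)
  \<comment> \<open>Initiality puts this coatom in the segment, so its meet with \<open>G'\<close>
    realizes \<open>H'\<close>.\<close>
  then have "sup a H' \<in> \<G>"
    using init G' \<open>(sup a H', G') \<in> r\<close> unfolding initial_segment_covered_by_def by blast
  moreover have "inf (sup a H') G' = H'"
    using K(2) by (simp add: inf_commute)
  ultimately show "H' \<in> coat_in \<G> G'"
    using H' unfolding coat_in_def mem_Collect_eq by (intro exI[of _ "sup a H'"]) simp
qed

theorem theorem3p3: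
  shows "\<exists>r :: ('a :: geometric_lattice \<times> 'a) set. total_coatom_ordering r"
proof -
  \<comment> \<open>Finiteness numbers the whole lattice; restricting \<open>f\<close> enumerates
    the atoms.\<close>
  obtain f :: "'a \<Rightarrow> nat" where f: "inj f"
    using finite_imp_inj_to_nat_seg[of "UNIV :: 'a set"] by auto
  have "total_coatom_ordering {(G, G' :: 'a). lex_less f G G'}"
    unfolding total_coatom_ordering_def
  proof (intro conjI allI ballI impI; (elim conjE)?)
    show "strict_linear_order {(G, G' :: 'a). lex_less f G G'}"
      using f by (rule strict_linear_order_lex_less)
  next
    fix F G G' :: 'a
    assume "G \<in> coat F" "G' \<in> coat F" "(G, G') \<in> {(G, G'). lex_less f G G'}"
    then show "\<exists>G'' \<in> coat F. (G'', G') \<in> {(G, G'). lex_less f G G'} \<and>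
        inf G' G'' \<in> coat G' \<and> inf G G' \<le> G''"
      using lex_less_coat_exchange by simp
  qed (rule initial_segment_coat_in)
  then show ?thesis
    by blast
qed

end
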